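(* For all $n\ge0$, $$H_n\big((2k+1)B_{2k}\big)=\frac{(-1)^n(2n+2)!}{n!(n+1)!^3}\cdot\left(\mathcal{H}_n+\mathcal{H}_{n+1}\right)\cdot H_n\big((2k+3)B_{2k+2}\big),$$ where $B_j$ are the Bernoulli numbers and $\mathcal{H}_m:=\sum_{j=1}^m\frac1j$ (with $\mathcal{H}_0=0$).
   Context: For a sequence $(a_k)_{k\ge 0}$ and $n\ge 0$, $H_n(a_k):=\det(a_{i+j})_{0\le i,j\le n}$ denotes the $(n+1)\times(n+1)$ Hankel determinant; in the claim the sequences are indexed by $k\ge0$. The Bernoulli numbers are defined by $\frac{t}{e^t-1}=\sum_{n\ge0}B_n\frac{t^n}{n!}$. The notation $(n+1)!^3$ means $((n+1)!)^3$. *)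

theory Defs
  imports
    "HOL-Computational_Algebra.Formal_Power_Series"
    "HOL-Analysis.Harmonic_Numbers"
    "Jordan_Normal_Form.Determinant"
begin

(* t / (e^t - 1) is taken as a quotient of formal power series. The denominator has
   subdegree 1, so it is not a unit; the lemma bernoulli_egf below confirms that
   the division is exact. *)
definition bernoulli :: "nat \<Rightarrow> real" where
  "bernoulli n = fact n * fps_nth (fps_X / (fps_exp 1 - 1)) n"

lemma bernoulli_egf:
  "Abs_fps (\<lambda>n. bernoulli n / fact n) * (fps_exp 1 - 1) = fps_X"
proof -
  let ?E = "fps_exp 1 - 1 :: real fps"
  have sd: "subdegree ?E = 1"
    by (rule subdegreeI) auto
  hence nz: "?E \<noteq> 0" by auto
  have "?E dvd fps_X"
    by (subst fps_dvd_iff) (use nz sd in auto)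
  moreover have "Abs_fps (\<lambda>n. bernoulli n / fact n) = fps_X / ?E"
    by (rule fps_ext) (simp add: bernoulli_def)
  ultimately show ?thesis by simp
qed

(* The index n gives a matrix of size n + 1. *)
definition hankel_det :: "nat \<Rightarrow> (nat \<Rightarrow> 'a :: comm_ring_1) \<Rightarrow> 'a" where
  "hankel_det n a = Determinant.det (mat (n + 1) (n + 1) (\<lambda>(i, j). a (i + j)))"

end

theory Submission
  imports Defs
begin

text \<open>
  Let \<open>M\<close> be the functional \<open>y\<^sup>k \<mapsto> (2k+1) B\<^bsub>2k\<^esub>\<close> and \<open>e\<^sub>k = \<Prod>\<^sub>j (y - j\<^sup>2)\<close>, \<open>1 \<le> j \<le> k\<close>.
  Telescoping gives \<open>M(e\<^sub>k) = (-1)\<^sup>k k!\<^sup>2 / (k+1)\<close>, and hence \<open>M(y e\<^sub>i e\<^sub>j)\<close> is, up to factors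
  depending on \<open>i\<close> or \<open>j\<close> alone, the Cauchy matrix \<open>1 / (i+j+2)\<close>. With columns \<open>e\<^sub>j\<close>, the left
  Hankel determinant has rows \<open>1, y e\<^sub>0, \<dots>, y e\<^bsub>n-1\<^esub>\<close> and the right one has rows
  \<open>y e\<^sub>0, \<dots>, y e\<^sub>n\<close>, so \<open>n\<close> rows are common. The vector annihilated by these comes from the partial
  fractions of \<open>R(s) = \<Prod>\<^sub>i (s - i) / \<Prod>\<^sub>j (s + j + 1)\<close>, \<open>1 \<le> i \<le> n\<close>, \<open>0 \<le> j \<le> n\<close>; on the two
  remaining rows it takes the values \<open>-R'(0)\<close> and, up to a factor, \<open>R(n+1)\<close>. The harmonic numbers are the
  logarithmic derivative of \<open>R\<close> at \<open>0\<close>.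
\<close>

section \<open>Moment functionals\<close>

definition moment :: "(nat \<Rightarrow> real) \<Rightarrow> real poly \<Rightarrow> real" where
  "moment a p = (\<Sum>i\<le>degree p. coeff p i * a i)"

lemma moment_eq:
  assumes "degree p < N"
  shows "moment a p = (\<Sum>i<N. coeff p i * a i)"
  unfolding moment_def
  by (rule sum.mono_neutral_left) (use assms in \<open>auto simp: coeff_eq_0\<close>)

lemma moment_add: "moment a (p + q) = moment a p + moment a q"
proof -
  define N where "N = Suc (max (degree p) (degree q))"
  have "degree (p + q) < N" "degree p < N" "degree q < N"
    using degree_add_le_max[of p q] by (auto simp: N_def)
  then show ?thesis
    by (simp add: moment_eq[where N = N] sum.distrib algebra_simps)
qed

lemma moment_smult: "moment a (smult c p) = c * moment a p"
proof -
  have "degree (smult c p) < Suc (degree p)" "degree p < Suc (degree p)"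
    using degree_smult_le[of c p] by auto
  then show ?thesis
    by (simp add: moment_eq[where N = "Suc (degree p)"] sum_distrib_left algebra_simps
        del: sum.lessThan_Suc)
qed

lemma moment_0 [simp]: "moment a 0 = 0"
  by (simp add: moment_def)

lemma moment_diff: "moment a (p - q) = moment a p - moment a q"
  using moment_add[of a "p - q" q] by simp

lemma moment_sum: "moment a (\<Sum>i\<in>I. f i) = (\<Sum>i\<in>I. moment a (f i))"
  by (induction I rule: infinite_finite_induct) (simp_all add: moment_add)

lemma moment_monom: "moment a (monom c n) = c * a n"
  by (cases "c = 0") (simp_all add: moment_def degree_monom_eq if_distrib if_distribR cong: if_cong)

lemma moment_pCons: "moment a (pCons c p) = c * a 0 + moment (\<lambda>k. a (Suc k)) p"
proof -
  have "degree (pCons c p) < Suc (Suc (degree p))"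
    using degree_pCons_le[of c p] by simp
  then have "moment a (pCons c p) = (\<Sum>i<Suc (Suc (degree p)). coeff (pCons c p) i * a i)"
    by (rule moment_eq)
  also have "\<dots> = c * a 0 + (\<Sum>i<Suc (degree p). coeff p i * a (Suc i))"
    by (subst sum.lessThan_Suc_shift) simp
  also have "(\<Sum>i<Suc (degree p). coeff p i * a (Suc i)) = moment (\<lambda>k. a (Suc k)) p"
    by (rule moment_eq[symmetric]) simp
  finally show ?thesis .
qed

text \<open>Under \<open>y = x^2\<close> a functional in \<open>y\<close> is read off from the even
  moments of one in \<open>x\<close>; this makes the shift \<open>x + 1\<close> available.\<close>

lemma moment_pcompose_square:
  "moment c (pcompose p [:0, 0, 1:]) = moment (\<lambda>k. c (2 * k)) p"
proof (induction p arbitrary: c)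
  case 0
  then show ?case by simp
next
  case (pCons x p)
  have "pcompose (pCons x p) [:0, 0, 1:] = [:x:] + pCons 0 (pCons 0 (pcompose p [:0, 0, 1:]))"
    by (simp add: pcompose_pCons)
  then have "moment c (pcompose (pCons x p) [:0, 0, 1:])
      = x * c 0 + moment (\<lambda>k. c (Suc (Suc k))) (pcompose p [:0, 0, 1:])"
    by (simp add: moment_add moment_pCons)
  also have "\<dots> = moment (\<lambda>k. c (2 * k)) (pCons x p)"
    by (subst pCons.IH) (simp add: moment_pCons)
  finally show ?case .
qed

lemma moment_mult:
  assumes "degree p < N" "degree q < N"
  shows "moment a (p * q) = (\<Sum>k<N. \<Sum>l<N. coeff p k * coeff q l * a (k + l))"
proof -
  have *: "r = (\<Sum>k<N. monom (coeff r k) k)" if "degree r < N" for r :: "real poly"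
    using poly_as_sum_of_monoms'[of r "N - 1"] that
    by (cases N) (simp_all add: lessThan_Suc_atMost)
  have "p * q = (\<Sum>k<N. \<Sum>l<N. monom (coeff p k * coeff q l) (k + l))"
    by (subst *[OF assms(1)], subst *[OF assms(2)]) (simp add: sum_product mult_monom)
  then show ?thesis
    by (simp add: moment_sum moment_monom)
qed

text \<open>The matrix factors as \<open>P * (A * Q)\<close> with \<open>A\<close> the Hankel matrix
  and \<open>P\<close>, \<open>Q\<close> the coefficient matrices, which are unitriangular.\<close>

lemma det_moment_monic:
  assumes "\<And>i. degree (p i) = i" "\<And>i. coeff (p i) i = 1"
    and "\<And>i. degree (q i) = i" "\<And>i. coeff (q i) i = 1"
  shows "Determinant.det (mat (n + 1) (n + 1) (\<lambda>(i, j). moment a (p i * q j))) = hankel_det n a"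
proof -
  define N where "N = n + 1"
  define P where "P = mat N N (\<lambda>(i, k). coeff (p i) k)"
  define Q where "Q = mat N N (\<lambda>(k, j). coeff (q j) k)"
  define A where "A = mat N N (\<lambda>(i, j). a (i + j))"
  have carr: "P \<in> carrier_mat N N" "Q \<in> carrier_mat N N" "A \<in> carrier_mat N N"
    by (auto simp: P_def Q_def A_def)
  have "Determinant.det P = prod_list (diag_mat P)"
    by (rule det_lower_triangular[OF _ carr(1)]) (auto simp: P_def coeff_eq_0 assms)
  also have "\<dots> = 1"
    using carr by (simp add: prod_list_diag_prod) (simp add: P_def assms)
  finally have dP: "Determinant.det P = 1" .
  have "Determinant.det Q = prod_list (diag_mat Q)"
    by (rule det_upper_triangular[OF _ carr(2)]) (auto simp: Q_def coeff_eq_0 assms)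
  also have "\<dots> = 1"
    using carr by (simp add: prod_list_diag_prod) (simp add: Q_def assms)
  finally have dQ: "Determinant.det Q = 1" .
  have "mat N N (\<lambda>(i, j). moment a (p i * q j)) = P * (A * Q)"
  proof (rule eq_matI)
    fix i j assume "i < dim_row (P * (A * Q))" "j < dim_col (P * (A * Q))"
    then have ij: "i < N" "j < N" using carr by auto
    then have "moment a (p i * q j)
        = (\<Sum>k<N. \<Sum>l<N. coeff (p i) k * coeff (q j) l * a (k + l))"
      by (intro moment_mult) (simp_all add: assms)
    also have "\<dots> = (P * (A * Q)) $$ (i, j)"
      using ij by (simp add: P_def Q_def A_def scalar_prod_def sum_distrib_left
          lessThan_atLeast0 mult_ac)
    finally show "mat N N (\<lambda>(i, j). moment a (p i * q j)) $$ (i, j) = (P * (A * Q)) $$ (i, j)"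
      using ij by simp
  qed (use carr in auto)
  then have "Determinant.det (mat N N (\<lambda>(i, j). moment a (p i * q j)))
      = Determinant.det P * (Determinant.det A * Determinant.det Q)"
    using carr by (simp add: det_mult[of _ N])
  then show ?thesis
    by (simp add: dP dQ A_def N_def hankel_det_def)
qed

section \<open>Bernoulli moments of the central factorials\<close>

text \<open>Compare coefficients of \<open>t^m\<close> in \<open>bernoulli_egf\<close>; the term
  \<open>i = m\<close> drops out because \<open>e^t - 1\<close> has constant term 0.\<close>

lemma bernoulli_recurrence:
  "(\<Sum>i<m. real (m choose i) * bernoulli i) = (if m = 1 then 1 else 0)"
proof -
  have "fps_nth (Abs_fps (\<lambda>n. bernoulli n / fact n) * (fps_exp 1 - 1)) m = fps_nth fps_X m"
    by (simp only: bernoulli_egf)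
  also have "fps_nth (Abs_fps (\<lambda>n. bernoulli n / fact n) * (fps_exp 1 - 1)) m
      = (\<Sum>i=0..m. bernoulli i / fact i * (if i = m then 0 else 1 / fact (m - i)))"
    unfolding fps_mult_nth by (rule sum.cong) auto
  also have "\<dots> = (\<Sum>i<m. bernoulli i / fact i / fact (m - i))"
    by (rule sum.mono_neutral_cong_right) auto
  also have "\<dots> = (\<Sum>i<m. real (m choose i) * bernoulli i) / fact m"
    by (simp add: sum_divide_distrib) (rule sum.cong, auto simp: binomial_fact)
  finally show ?thesis
    by (auto simp: field_simps split: if_splits)
qed

text \<open>With \<open>L(x^k) = B_k\<close>, the functional sends \<open>p\<close> to
  \<open>L(p')\<close>. Since \<open>L(q(x+1)) - L(q(x)) = q'(0)\<close>, taking
  \<open>q = p'\<close> gives \<open>p''(0)\<close>. The factor \<open>n\<close> in \<open>c\<close>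
  makes the truncated \<open>n - 1\<close> harmless at 0.\<close>

lemma moment_bernoulli_shift:
  fixes p :: "real poly"
  defines "c \<equiv> \<lambda>n. real n * bernoulli (n - 1)"
  shows "moment c (pcompose p [:1, 1:]) - moment c p = 2 * coeff p 2"
proof -
  have mono: "moment c ([:1, 1:] ^ n) - c n = (if n = 2 then 2 else 0)" for n
  proof (cases n)
    case 0
    then show ?thesis by (simp add: moment_def c_def)
  next
    case (Suc m)
    have "[:1, 1:] ^ n = (monom 1 1 + 1 :: real poly) ^ n"
      by (simp add: monom_altdef one_pCons)
    also have "\<dots> = (\<Sum>k\<le>n. monom (real (n choose k)) k)"
      by (simp add: binomial_ring monom_power of_nat_poly smult_monom)
    finally have "moment c ([:1, 1:] ^ n) - c n = (\<Sum>k<n. real (n choose k) * c k)"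
      by (simp add: moment_add moment_sum moment_monom flip: lessThan_Suc_atMost)
    also have "\<dots> = (\<Sum>k<m. real (n choose Suc k) * c (Suc k))"
      unfolding Suc by (subst sum.lessThan_Suc_shift) (simp add: c_def)
    also have "\<dots> = (\<Sum>k<m. real n * (real (m choose k) * bernoulli k))"
    proof (rule sum.cong)
      fix k
      \<comment> \<open>Absorption reduces the sum to the Bernoulli recurrence for
        \<open>m = n - 1\<close>.\<close>
      have "real (Suc k) * real (Suc m choose Suc k) = real (Suc m) * real (m choose k)"
        by (metis Suc_times_binomial_eq of_nat_mult mult.commute)
      from arg_cong[OF this, of "\<lambda>x. x * bernoulli k"]
      show "real (n choose Suc k) * c (Suc k) = real n * (real (m choose k) * bernoulli k)"
        by (simp only: c_def Suc diff_Suc_1 mult_ac)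
    qed simp
    also have "\<dots> = (if n = 2 then 2 else 0)"
      by (simp add: bernoulli_recurrence Suc flip: sum_distrib_left)
    finally show ?thesis .
  qed
  have p: "p = (\<Sum>i\<le>degree p. smult (coeff p i) (monom 1 i))"
    by (simp add: smult_monom poly_as_sum_of_monoms)
  have "pcompose p [:1, 1:] = (\<Sum>i\<le>degree p. smult (coeff p i) ([:1, 1:] ^ i))"
  proof -
    have "pcompose (monom 1 i) [:1, 1:] = ([:1, 1:] :: real poly) ^ i" for i
      by (induction i) (simp_all add: monom_altdef pcompose_mult pcompose_pCons)
    with arg_cong[OF p, of "\<lambda>p. pcompose p [:1, 1:]"] show ?thesis
      by (simp only: pcompose_sum pcompose_smult)
  qed
  then have "moment c (pcompose p [:1, 1:]) - moment c p
      = (\<Sum>i\<le>degree p. coeff p i * (moment c ([:1, 1:] ^ i) - c i))"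
    by (simp add: moment_sum moment_smult moment_def[of c p] sum_subtractf algebra_simps)
  also have "\<dots> = (if 2 \<le> degree p then 2 * coeff p 2 else 0)"
    by (simp add: mono if_distrib cong: if_cong)
  also have "\<dots> = 2 * coeff p 2"
    by (simp add: coeff_eq_0)
  finally show ?thesis .
qed

section \<open>Central factorials and their moments\<close>

definition cfact :: "nat \<Rightarrow> real poly" where
  "cfact k = (\<Prod>j<k. [:- (real (Suc j))\<^sup>2, 1:])"

lemma cfact_0 [simp]: "cfact 0 = 1"
  and cfact_Suc: "cfact (Suc k) = cfact k * [:- (real (Suc k))\<^sup>2, 1:]"
  by (simp_all add: cfact_def)

lemma cfact_monic: "degree (cfact k) = k" "coeff (cfact k) k = 1"
proof -
  have *: "degree (cfact k) = k \<and> lead_coeff (cfact k) = 1"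
  proof (induction k)
    case (Suc k)
    have "degree (cfact (Suc k)) = Suc k"
      unfolding cfact_Suc using Suc by (subst degree_mult_eq) auto
    moreover have "lead_coeff (cfact (Suc k)) = 1"
      unfolding cfact_Suc lead_coeff_mult by (simp add: conjunct2[OF Suc.IH])
    ultimately show ?case by simp
  qed simp
  then show "degree (cfact k) = k" by (rule conjunct1)
  from conjunct2[OF *] this show "coeff (cfact k) k = 1" by (simp only:)
qed

lemma poly_cfact_0: "poly (cfact k) 0 = (-1) ^ k * (fact k)\<^sup>2"
  by (induction k) (simp_all add: cfact_Suc power2_eq_square algebra_simps)

text \<open>\<open>x * cfact k (x^2)\<close> is the product of the consecutive factors
  \<open>x - k, ..., x + k\<close>; both sides equal the product from \<open>x - k\<close> to
  \<open>x + k + 1\<close>.\<close>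

lemma cfact_shift:
  fixes x :: real
  shows "(x - real k) * ((x + 1) * poly (cfact k) ((x + 1)\<^sup>2))
    = (x + 1 + real k) * (x * poly (cfact k) (x\<^sup>2))"
proof (induction k)
  case (Suc k)
  have "(x - real (Suc k)) * ((x + 1) * poly (cfact (Suc k)) ((x + 1)\<^sup>2))
    = (x - real (Suc k)) * (x + 2 + real k)
      * ((x - real k) * ((x + 1) * poly (cfact k) ((x + 1)\<^sup>2)))"
    by (simp add: cfact_Suc power2_eq_square algebra_simps)
  also have "\<dots> = (x + 1 + real (Suc k)) * (x * poly (cfact (Suc k)) (x\<^sup>2))"
    unfolding Suc.IH by (simp add: cfact_Suc power2_eq_square algebra_simps)
  finally show ?case .
qed simp

abbreviation (input) a_seq :: "nat \<Rightarrow> real" where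
  "a_seq k \<equiv> real (2 * k + 1) * bernoulli (2 * k)"

text \<open>
  The polynomial \<open>F = (x - k - 1) x \<Prod>\<^sub>j (x\<^sup>2 - j\<^sup>2)\<close> is a multiple of the binomial coefficient
  \<open>x + k\<close> over \<open>2k + 2\<close>, so its forward difference is a multiple of \<open>x \<Prod>\<^sub>j (x\<^sup>2 - j\<^sup>2)\<close>.
\<close>

lemma moment_cfact: "moment a_seq (cfact k) = (-1) ^ k * (fact k)\<^sup>2 / real (k + 1)"
proof -
  define c where "c = (\<lambda>n. real n * bernoulli (n - 1))"
  define G where "G = pCons 0 (pcompose (cfact k) [:0, 0, 1:])"
  define F where "F = [:- real (k + 1), 1:] * G"
  have polyG: "poly G x = x * poly (cfact k) (x\<^sup>2)" for x
    by (simp add: G_def poly_pcompose power2_eq_square)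
  have "pcompose F [:1, 1:] - F = smult (2 * real (k + 1)) G"
  proof (rule poly_ext)
    fix x
    show "poly (pcompose F [:1, 1:] - F) x = poly (smult (2 * real (k + 1)) G) x"
      using cfact_shift[of x k]
      by (simp add: F_def poly_pcompose polyG algebra_simps)
  qed
  then have "2 * real (k + 1) * moment c G = moment c (pcompose F [:1, 1:]) - moment c F"
    by (metis moment_diff moment_smult)
  also have "\<dots> = 2 * coeff F 2"
    unfolding c_def by (rule moment_bernoulli_shift)
  also have "coeff F 2 = poly (cfact k) 0"
  proof -
    \<comment> \<open>\<open>G\<close> is odd, so the \<open>x^2\<close> coefficient of
      \<open>F\<close> is just the \<open>x\<close> coefficient of \<open>G\<close>.\<close>
    have "coeff (pcompose q [:0, 0, 1:]) (Suc 0) = 0" for q :: "real poly"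
      by (cases q) (simp add: pcompose_pCons)
    then show ?thesis
      by (simp add: F_def G_def numeral_2_eq_2)
  qed
  also have "moment c G = moment a_seq (cfact k)"
    by (simp add: G_def moment_pCons moment_pcompose_square c_def)
  finally show ?thesis
    by (simp add: poly_cfact_0 field_simps)
qed

text \<open>The last factor of \<open>cfact (Suc i)\<close> is traded for the next factor of
  \<open>cfact j\<close>, at the cost of a scalar multiple of the case \<open>i\<close>,
  \<open>j\<close>; hence \<open>j\<close> varies in the induction.\<close>

lemma moment_cfact_mult:
  "moment a_seq (pCons 0 (cfact i) * cfact j)
    = (-1) ^ (i + j) * fact i * fact (i + 1) * fact j * fact (j + 1) / real (i + j + 2)"
proof (induction i arbitrary: j)
  case 0
  have eq: "pCons 0 (cfact 0) * cfact j = cfact (Suc j) + smult ((real (Suc j))\<^sup>2) (cfact j)"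
    by (simp add: cfact_Suc)
  have "moment a_seq (pCons 0 (cfact 0) * cfact j)
      = (-1) ^ Suc j * (fact (Suc j))\<^sup>2 / real (Suc j + 1)
        + (real (Suc j))\<^sup>2 * ((-1) ^ j * (fact j)\<^sup>2 / real (j + 1))"
    unfolding eq moment_add moment_smult moment_cfact ..
  also have "\<dots> = (-1) ^ (0 + j) * fact 0 * fact (0 + 1) * fact j * fact (j + 1) / real (0 + j + 2)"
    by (simp add: power2_eq_square divide_simps) (simp add: algebra_simps)
  finally show ?case .
next
  case (Suc i)
  have eq: "pCons 0 (cfact (Suc i)) * cfact j = pCons 0 (cfact i) * cfact (Suc j)
      + smult ((real (Suc j))\<^sup>2 - (real (Suc i))\<^sup>2) (pCons 0 (cfact i) * cfact j)"
    by (simp add: cfact_Suc smult_diff_left algebra_simps)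
  have nz: "real i + real j + 2 \<noteq> 0" "real i + real j + 3 \<noteq> 0"
    by linarith+
  define X where "X = (-1) ^ (i + j) * fact i * fact (i + 1) * fact j * (fact (j + 1) :: real)"
  have "moment a_seq (pCons 0 (cfact (Suc i)) * cfact j)
      = - X * (real j + 1) * (real j + 2) / (real i + real j + 3)
        + ((real j + 1)\<^sup>2 - (real i + 1)\<^sup>2) * (X / (real i + real j + 2))"
    unfolding eq moment_add moment_smult Suc.IH by (simp add: X_def algebra_simps)
  \<comment> \<open>The difference of squares contains the factor \<open>i + j + 2\<close>, which
    cancels.\<close>
  also have "\<dots> = - X * (real i + 1) * (real i + 2) / (real i + real j + 3)"
    using nz by (simp add: power2_eq_square divide_simps) (simp add: algebra_simps)
  also have "\<dots> = (-1) ^ (Suc i + j) * fact (Suc i) * fact (Suc i + 1) * fact j * fact (j + 1)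
      / real (Suc i + j + 2)"
    by (simp add: X_def algebra_simps)
  finally show ?case .
qed

section \<open>Partial fractions\<close>

definition ratfun :: "nat \<Rightarrow> real \<Rightarrow> real" where
  "ratfun n s = (\<Prod>i<n. s - real (Suc i)) / (\<Prod>j\<le>n. s + real j + 1)"

lemma ratfun_Suc: "ratfun (Suc n) s = ratfun n s * ((s - real (Suc n)) / (s + real (Suc n) + 1))"
  by (simp add: ratfun_def)

text \<open>The coefficients enter later only through values and the derivative of
  \<open>ratfun\<close>, so existence suffices. The range \<open>s > -1\<close> avoids all poles and
  contains a neighbourhood of 0.\<close>

lemma ratfun_partial_fractions:
  "\<exists>v. \<forall>s>-1. (\<Sum>j\<le>n. v j / (s + real j + 1)) = ratfun n s"
proof (induction n)
  case 0
  show ?case by (rule exI[of _ "\<lambda>_. 1"]) (simp add: ratfun_def)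
next
  case (Suc n)
  then obtain v where v: "\<And>s. s > -1 \<Longrightarrow> (\<Sum>j\<le>n. v j / (s + real j + 1)) = ratfun n s"
    by blast
  define N where "N = real (Suc n)"
  \<comment> \<open>Residues after multiplying by \<open>(s - N) / (s + N + 1)\<close>:
    \<open>u j\<close> at the old pole \<open>-(j + 1)\<close>, \<open>w\<close> at the new pole
    \<open>-(N + 1)\<close>.\<close>
  define u where "u j = v j * (- (real j + 1) - N) / (N - real j)" for j
  define w where "w = (\<Sum>j\<le>n. v j * (2 * N + 1) / (N - real j))"
  have "(\<Sum>j\<le>Suc n. (if j \<le> n then u j else w) / (s + real j + 1)) = ratfun (Suc n) s"
    if s: "s > -1" for s
  proof -
    have "ratfun (Suc n) s = (\<Sum>j\<le>n. v j / (s + real j + 1) * ((s - N) / (s + N + 1)))"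
      by (simp only: ratfun_Suc v[OF s, symmetric] sum_distrib_right N_def)
    also have "\<dots> = (\<Sum>j\<le>n. u j / (s + real j + 1)
        + v j * (2 * N + 1) / (N - real j) / (s + N + 1))"
    proof (rule sum.cong)
      fix j assume "j \<in> {..n}"
      then have nz: "N - real j \<noteq> 0" "s + real j + 1 \<noteq> 0" "s + N + 1 \<noteq> 0"
        using s by (auto simp: N_def)
      have "(s - N) / ((s + real j + 1) * (s + N + 1))
          = (- (real j + 1) - N) / (N - real j) / (s + real j + 1)
            + (2 * N + 1) / (N - real j) / (s + N + 1)"
        using nz by (simp add: divide_simps) (simp add: algebra_simps)
      from arg_cong[OF this, of "\<lambda>x. v j * x"]
      show "v j / (s + real j + 1) * ((s - N) / (s + N + 1))
          = u j / (s + real j + 1) + v j * (2 * N + 1) / (N - real j) / (s + N + 1)"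
        by (simp add: u_def algebra_simps)
    qed simp
    also have "\<dots> = (\<Sum>j\<le>n. u j / (s + real j + 1)) + w / (s + N + 1)"
      by (simp add: sum.distrib w_def sum_divide_distrib)
    finally show ?thesis by (simp add: N_def)
  qed
  then show ?case
    by (intro exI[of _ "\<lambda>j. if j \<le> n then u j else w"] allI impI)
qed

lemma ratfun_root: "i < n \<Longrightarrow> ratfun n (real (i + 1)) = 0"
  by (auto simp: ratfun_def intro!: bexI[of _ i])

lemma ratfun_0: "ratfun n 0 = (-1) ^ n / real (n + 1)"
proof (induction n)
  case 0
  show ?case by (simp add: ratfun_def)
next
  case (Suc n)
  have "real n + 1 \<noteq> 0" "real n + 2 \<noteq> 0" by linarith+
  then show ?case
    by (simp add: ratfun_Suc Suc.IH divide_simps) (simp add: algebra_simps)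
qed

lemma ratfun_Suc_n: "ratfun n (real (n + 1)) = fact n * fact (n + 1) / fact (2 * n + 2)"
proof -
  have "(\<Prod>i<n. real (n + 1) - real (Suc i)) = fact n"
  proof -
    have "(\<Prod>i<n. real (n + 1) - real (Suc i)) = (\<Prod>i<n. real (n - i))"
      by (rule prod.cong) auto
    also have "\<dots> = fact n"
      by (simp add: fact_prod_rev lessThan_atLeast0)
    finally show ?thesis .
  qed
  \<comment> \<open>The upper limit is freed as \<open>m\<close>, since \<open>n\<close> also occurs
    inside the factors.\<close>
  moreover have "(\<Prod>j\<le>m. real (n + 1) + real j + 1) = fact (n + m + 2) / fact (n + 1)" for m
  proof (induction m)
    case 0
    show ?case by (simp add: divide_simps)
  next
    case (Suc m)
    then show ?case by (simp add: divide_simps)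
  qed
  ultimately have "ratfun n (real (n + 1)) = fact n / (fact (n + n + 2) / fact (n + 1))"
    by (simp only: ratfun_def)
  then show ?thesis
    by (simp only: mult_2 divide_divide_eq_right)
qed

lemma ratfun_deriv_0:
  "(ratfun n has_real_derivative - (harm n + harm (n + 1)) * ratfun n 0) (at 0)"
proof (induction n)
  case 0
  have "((\<lambda>s. 1 / (s + 1)) has_real_derivative -1) (at 0)"
    by (auto intro!: derivative_eq_intros)
  then show ?case
    by (simp add: ratfun_def [abs_def] harm_def)
next
  case (Suc n)
  define N where "N = real (Suc n)"
  have N: "N > 0" by (simp add: N_def)
  \<comment> \<open>The derivative is written as logarithmic derivative times value at 0.\<close>
  have "((\<lambda>s. (s - N) / (s + N + 1)) has_real_derivative
      (- (1 / N + 1 / (N + 1))) * (- N / (N + 1))) (at 0)"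
    using N by (auto intro!: derivative_eq_intros simp: divide_simps)
  from DERIV_mult[OF Suc.IH this]
  have "(ratfun (Suc n) has_real_derivative
      - (harm n + harm (n + 1)) * ratfun n 0 * ((0 - N) / (0 + N + 1))
      + - (1 / N + 1 / (N + 1)) * (- N / (N + 1)) * ratfun n 0) (at 0)"
    by (simp only: ratfun_Suc [abs_def] N_def)
  moreover have "harm (Suc n) = harm n + 1 / N" "harm (Suc n + 1) = harm (n + 1) + 1 / (N + 1)"
    by (simp_all add: harm_Suc N_def inverse_eq_divide add.commute)
  moreover have "ratfun (Suc n) 0 = ratfun n 0 * (- N / (N + 1))"
    by (simp add: ratfun_Suc N_def)
  moreover have "- (A + B) * R * ((0 - N) / (0 + N + 1)) + - (1 / N + 1 / (N + 1)) * (- N / (N + 1)) * R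
      = - (A + 1 / N + (B + 1 / (N + 1))) * (R * (- N / (N + 1)))" for A B R
    using N by (simp add: divide_simps) (simp add: algebra_simps)
  ultimately show ?case
    by (simp only:)
qed

section \<open>Determinants with all but one row in common\<close>

text \<open>The determinant is linear in the first row. The combination \<open>z\<close> of
  \<open>f\<close> and \<open>g\<close> is orthogonal to \<open>w\<close>, as are the rows
  \<open>h i\<close>, and \<open>w\<close> is nonzero by \<open>nz\<close>, so \<open>T z\<close> is
  singular.\<close>

lemma det_replace_first_row:
  fixes f g :: "nat \<Rightarrow> real" and h :: "nat \<Rightarrow> nat \<Rightarrow> real"
  assumes ker: "\<And>i. i < n \<Longrightarrow> (\<Sum>j\<le>n. h i j * w j) = 0"
    and nz: "(\<Sum>j\<le>n. g j * w j) \<noteq> 0"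
  defines "T \<equiv> \<lambda>f. mat (n + 1) (n + 1) (\<lambda>(i, j). if i = 0 then f j else h (i - 1) j)"
  shows "Determinant.det (T f) * (\<Sum>j\<le>n. g j * w j) = Determinant.det (T g) * (\<Sum>j\<le>n. f j * w j)"
proof -
  define ev where "ev f = (\<Sum>j\<le>n. f j * w j)" for f
  define z where "z j = ev g * f j - ev f * g j" for j
  have carr: "T f \<in> carrier_mat (n + 1) (n + 1)" for f
    by (simp add: T_def)
  have cof: "cofactor (T f) 0 j = cofactor (T g) 0 j" for f g j
  proof -
    have "mat_delete (T f) 0 j = mat_delete (T g) 0 j"
      by (rule eq_matI) (auto simp: mat_delete_def T_def)
    then show ?thesis by (simp add: cofactor_def)
  qed
  have lap: "Determinant.det (T f) = (\<Sum>j\<le>n. f j * cofactor (T g) 0 j)" for f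
  proof -
    have "Determinant.det (T f) = (\<Sum>j<n+1. T f $$ (0, j) * cofactor (T f) 0 j)"
      by (rule laplace_expansion_row[OF carr]) simp
    also have "\<dots> = (\<Sum>j\<le>n. f j * cofactor (T g) 0 j)"
      unfolding cof[of f _ g] by (rule sum.cong) (auto simp: T_def)
    finally show ?thesis .
  qed
  have "Determinant.det (T z) = 0"
  proof -
    have "ev z = 0"
      by (simp add: z_def ev_def sum_subtractf left_diff_distrib sum_distrib_left
          flip: mult.assoc) (simp add: mult.assoc flip: sum_distrib_left)
    then have "(\<Sum>j\<le>n. (if i = 0 then z j else h (i - 1) j) * w j) = 0" if "i < Suc n" for i
      using that ker[of "i - 1"] by (cases i) (simp_all add: ev_def)
    then have "T z *\<^sub>v vec (n + 1) w = 0\<^sub>v (n + 1)"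
      by (intro eq_vecI)
         (auto simp: T_def scalar_prod_def atLeast0LessThan lessThan_Suc_atMost
           simp del: sum.lessThan_Suc sum.op_ivl_Suc)
    moreover have "vec (n + 1) w \<noteq> 0\<^sub>v (n + 1)"
    proof
      assume "vec (n + 1) w = 0\<^sub>v (n + 1)"
      then have "w j = 0" if "j \<le> n" for j
        using that by (metis index_vec index_zero_vec(1) le_imp_less_Suc Suc_eq_plus1)
      then show False using nz by simp
    qed
    ultimately show ?thesis
      using det_0_iff_vec_prod_zero_field[OF carr] vec_carrier by blast
  qed
  moreover have "Determinant.det (T z) = ev g * Determinant.det (T f) - ev f * Determinant.det (T g)"
    by (simp add: lap z_def left_diff_distrib sum_subtractf sum_distrib_left mult.assoc)
  ultimately show ?thesis
    by (simp add: ev_def mult.commute)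
qed

section \<open>Comparison of the two Hankel determinants\<close>

theorem proposition6p2:
  fixes n :: nat
  shows "hankel_det n (\<lambda>k. real (2 * k + 1) * bernoulli (2 * k)) =
    (-1) ^ n * fact (2 * n + 2) / (fact n * fact (n + 1) ^ 3) *
    (harm n + harm (n + 1)) *
    hankel_det n (\<lambda>k. real (2 * k + 3) * bernoulli (2 * k + 2))"
proof -
  define h where "h i j = moment a_seq (pCons 0 (cfact i) * cfact j)" for i j
  define f where "f j = moment a_seq (cfact j)" for j
  define T where "T g = mat (n + 1) (n + 1) (\<lambda>(i, j). if i = 0 then g j else h (i - 1) j)" for g
  define b where "b k = real (2 * k + 3) * bernoulli (2 * k + 2)" for k
  define B where "B = mat (n + 1) (n + 1) (\<lambda>(i, j). h i j)"
  define p where "p i = (case i of 0 \<Rightarrow> 1 | Suc i \<Rightarrow> pCons 0 (cfact i))" for i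
  obtain v where v: "\<And>s. s > -1 \<Longrightarrow> (\<Sum>j\<le>n. v j / (s + real j + 1)) = ratfun n s"
    using ratfun_partial_fractions by blast
  \<comment> \<open>The denominator cancels the column factor of \<open>h i j\<close>, leaving the
    Cauchy kernel.\<close>
  define w where "w j = v j / ((-1) ^ j * fact j * fact (j + 1))" for j

  have "degree (p i) = i" "coeff (p i) i = 1" for i
    using cfact_monic[of "i - 1"] by (auto simp: p_def split: nat.split)
  then have "hankel_det n a_seq
      = Determinant.det (mat (n + 1) (n + 1) (\<lambda>(i, j). moment a_seq (p i * cfact j)))"
    by (intro det_moment_monic[symmetric] cfact_monic)
  also have "mat (n + 1) (n + 1) (\<lambda>(i, j). moment a_seq (p i * cfact j)) = T f"
    by (rule eq_matI) (auto simp: T_def f_def h_def p_def split: nat.split)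
  finally have detA: "hankel_det n a_seq = Determinant.det (T f)" .

  have h_b: "h i j = moment b (cfact i * cfact j)" for i j
    by (simp add: h_def b_def[abs_def] moment_pCons add.commute)
  have detB: "Determinant.det B = hankel_det n b"
    unfolding B_def h_b by (intro det_moment_monic cfact_monic)
  \<comment> \<open>The last row of \<open>B\<close> passes \<open>n\<close> rows on its way to the
    front, whence the sign.\<close>
  have "T (h n) = swap_row_to_front B n"
    by (subst swap_row_to_front_result[where n = "n + 1"])
       (auto simp: B_def T_def intro!: eq_matI)
  then have detT: "Determinant.det (T (h n)) = (-1) ^ n * hankel_det n b"
    using swap_row_to_front_det[of B "n + 1" n] detB by (simp add: B_def)

  have ev_h: "(\<Sum>j\<le>n. h i j * w j) = (-1) ^ i * fact i * fact (i + 1) * ratfun n (real (i + 1))" for i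
  proof -
    have "(\<Sum>j\<le>n. h i j * w j)
        = (\<Sum>j\<le>n. (-1) ^ i * fact i * fact (i + 1) * (v j / (real (i + 1) + real j + 1)))"
    proof (rule sum.cong)
      fix j
      define X :: real where "X = (-1) ^ j * fact j * fact (j + 1)"
      have "X \<noteq> 0" by (simp add: X_def)
      moreover have "w j = v j / X" by (simp add: w_def X_def)
      moreover have "h i j = (-1) ^ i * fact i * fact (i + 1) * (X / (real (i + 1) + real j + 1))"
        unfolding h_def moment_cfact_mult by (simp add: X_def power_add ac_simps)
      ultimately show "h i j * w j
          = (-1) ^ i * fact i * fact (i + 1) * (v j / (real (i + 1) + real j + 1))"
        by simp
    qed simp
    also have "\<dots> = (-1) ^ i * fact i * fact (i + 1) * ratfun n (real (i + 1))"
      by (simp only: v[of "real (i + 1)", symmetric] flip: sum_distrib_left)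
    finally show ?thesis .
  qed
  have ev_f: "(\<Sum>j\<le>n. f j * w j) = (harm n + harm (n + 1)) * ratfun n 0"
  proof -
    \<comment> \<open>One factor \<open>1 / (j + 1)\<close> comes from the moment of
      \<open>cfact j\<close>, the other from \<open>w j\<close>; their product points to the
      derivative at 0.\<close>
    have "((\<lambda>s. \<Sum>j\<le>n. v j / (s + real j + 1)) has_real_derivative
        (\<Sum>j\<le>n. - v j / (real j + 1)\<^sup>2)) (at 0)"
      by (auto intro!: derivative_eq_intros simp: power2_eq_square)
    moreover have "((\<lambda>s. \<Sum>j\<le>n. v j / (s + real j + 1)) has_real_derivative
        - (harm n + harm (n + 1)) * ratfun n 0) (at 0)"
      by (rule has_field_derivative_transform_within_open[OF ratfun_deriv_0, of "{-1<..}"])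
         (simp_all add: v)
    ultimately have "(\<Sum>j\<le>n. - v j / (real j + 1)\<^sup>2) = - (harm n + harm (n + 1)) * ratfun n 0"
      by (rule DERIV_unique)
    moreover have "f j * w j = v j / (real j + 1)\<^sup>2" for j
    proof -
      define X :: real where "X = (-1) ^ j * fact j * fact j"
      have "X \<noteq> 0" by (simp add: X_def)
      moreover have "w j = v j / (X * (real j + 1))"
        by (simp add: w_def X_def algebra_simps)
      moreover have "f j = X / (real j + 1)"
        unfolding f_def moment_cfact by (simp add: X_def power2_eq_square ac_simps)
      ultimately show ?thesis by (simp add: power2_eq_square)
    qed
    ultimately show ?thesis
      by (simp add: sum_negf algebra_simps)
  qed

  have nz: "(\<Sum>j\<le>n. h n j * w j) \<noteq> 0"
    unfolding ev_h ratfun_Suc_n by simp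
  have "Determinant.det (T f) * (\<Sum>j\<le>n. h n j * w j)
      = Determinant.det (T (h n)) * (\<Sum>j\<le>n. f j * w j)"
    unfolding T_def by (rule det_replace_first_row[OF _ nz]) (simp only: ev_h ratfun_root mult_zero_right)
  then have det_eq: "Determinant.det (T f) * ((-1) ^ n * fact n * fact (n + 1) * (fact n * fact (n + 1) / fact (2 * n + 2)))
      = (-1) ^ n * hankel_det n b * ((harm n + harm (n + 1)) * ((-1) ^ n / real (n + 1)))"
    by (simp only: detT ev_f ev_h ratfun_0 ratfun_Suc_n)
  \<comment> \<open>Here \<open>e\<close> is the sign, \<open>K\<close>, \<open>F\<close>,
    \<open>G\<close> are the factorials of \<open>2n + 2\<close>, \<open>n\<close>,
    \<open>n + 1\<close>, and \<open>m\<close> is \<open>n + 1\<close>; abstract letters keep the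
    field arithmetic free of factorials.\<close>
  have solve: "D = e * K / (F * G ^ 3) * S * H"
    if "D * (e * F * G * (F * G / K)) = e * H * (S * (e / m))"
      and "e * e = 1" "G = m * F" "F \<noteq> 0" "K \<noteq> 0" "m \<noteq> 0"
    for D e F G K S H m :: real
  proof -
    have "e * e * (D * (F * G * (F * G / K))) = e * e * (e * H * S / m)"
      using arg_cong[OF that(1), of "\<lambda>x. e * x"] by (simp add: ac_simps)
    then have "D * (F * G * (F * G / K)) = e * H * S / m"
      by (simp only: \<open>e * e = 1\<close> mult_1)
    then show ?thesis
      using that by (simp add: field_simps power3_eq_cube)
  qed
  from det_eq have "Determinant.det (T f) = (-1) ^ n * fact (2 * n + 2) / (fact n * fact (n + 1) ^ 3) *
      (harm n + harm (n + 1)) * hankel_det n b"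
    by (rule solve[where m = "real (n + 1)"]) (simp_all flip: power_mult_distrib)
  with detA show ?thesis
    unfolding b_def by simp
qed

end
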